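(* Let $A, B$ be $n \times n$ complex matrices, where $A$ is positive semidefinite and $B$ is normal. Then $AB$ is similar to $BA$.
   Context: $X^*$ denotes the conjugate transpose of a complex matrix $X$. A square complex matrix $B$ is normal if $BB^* = B^*B$. Positive semidefinite means Hermitian with $v^*Av \ge 0$ for all $v \in \mathbb{C}^n$. Two $n \times n$ complex matrices $X, Y$ are similar if there is an invertible $n\times n$ complex matrix $S$ with $SX = YS$. *)

theory Defs
  imports "Jordan_Normal_Form.Schur_Decomposition"
begin

definition normal_mat :: "complex mat \<Rightarrow> bool" where
  "normal_mat B \<longleftrightarrow> square_mat B \<and> B * mat_adjoint B = mat_adjoint B * B"

(* The order on complex numbers is that of HOL-Library.Complex_Order: 0 \<le> z means that
   z is real and nonnegative. *)
definition psd_mat :: "complex mat \<Rightarrow> bool" where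
  "psd_mat A \<longleftrightarrow> square_mat A \<and> mat_adjoint A = A \<and>
     (\<forall>v \<in> carrier_vec (dim_row A). 0 \<le> conjugate v \<bullet> (A *\<^sub>v v))"

end

theory Submission
  imports Defs "Jordan_Normal_Form.Jordan_Normal_Form_Existence"
    "Jordan_Normal_Form.Jordan_Normal_Form_Uniqueness"
begin

text \<open>Two complex matrices are similar as soon as, for every scalar \<open>e\<close> and every \<open>k\<close>, the kernels
  of the \<open>k\<close>-th powers of \<open>X - e\<close> and \<open>Y - e\<close> have the same dimension, because these dimensions count
  the Jordan blocks (\<open>similar_mat_of_dim_gen_eigenspace\<close>). For \<open>X = AB\<close>, \<open>Y = BA\<close> and \<open>e \<noteq> 0\<close> the
  dimensions agree for any matrices \<open>A\<close> and \<open>B\<close>: multiplication by \<open>B\<close> embeds the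
  generalized eigenspaces of \<open>AB\<close> into those of \<open>BA\<close>, and multiplication by \<open>A\<close> embeds them back
  (\<open>dim_gen_eigenspace_nonzero_le\<close>).

  The hypotheses on \<open>A\<close> and \<open>B\<close> are needed for \<open>e = 0\<close>, where one has to show
  \<open>dim ker (AB)\<^sup>k = dim ker (BA)\<^sup>k\<close> (\<open>kernel_dim_pow_psd_normal_commute\<close>). Kernels of a matrix and of its
  adjoint have the same dimension, and \<open>((AB)\<^sup>k)\<^sup>* = (B\<^sup>*A)\<^sup>k\<close>; so it is enough to compare
  \<open>(BA)\<^sup>k\<close> with \<open>(B\<^sup>*A)\<^sup>k\<close>. The key fact (\<open>psd_normal_mult_vec_eq_0\<close>) is that \<open>BABz = 0\<close>
  implies \<open>ABz = 0\<close>. Indeed, a normal matrix and its adjoint have the same kernel, so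
  \<open>B\<^sup>*ABz = 0\<close>, hence \<open>\<langle>A(Bz), Bz\<rangle> = 0\<close>, and for positive semidefinite \<open>A\<close> this gives
  \<open>A(Bz) = 0\<close>. Therefore, for \<open>k \<ge> 2\<close>, the matrix \<open>(BA)\<^sup>k\<close> has the same kernel as \<open>A(BA)\<^sup>k\<^sup>-\<^sup>1\<close>, whose
  adjoint \<open>A(B\<^sup>*A)\<^sup>k\<^sup>-\<^sup>1\<close> in turn has the kernel of \<open>(B\<^sup>*A)\<^sup>k\<close>. The case \<open>k = 1\<close> only needs that \<open>B\<close> and
  \<open>B\<^sup>*\<close> have the same kernel.\<close>


section \<open>Dimensions of kernels\<close>

text \<open>A subspace \<open>U\<close> of the vectors of length \<open>n\<close>, read as a space of its own, so that it has
  a dimension and can be the domain or codomain of a linear map. For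
  \<open>U = mat_kernel A\<close> its dimension is \<^const>\<open>kernel_dim\<close> of \<open>A\<close> by definition.\<close>
abbreviation sub_vs :: "nat \<Rightarrow> 'a :: field vec set \<Rightarrow> ('a, 'a vec) module" where
  "sub_vs n U \<equiv> (module_vec TYPE('a) n)\<lparr>carrier := U\<rparr>"

lemma subspace_vecI:
  fixes U :: "'a :: field vec set"
  assumes "U \<subseteq> carrier_vec n" "0\<^sub>v n \<in> U"
    and "\<And>v w. v \<in> U \<Longrightarrow> w \<in> U \<Longrightarrow> v + w \<in> U"
    and "\<And>c v. v \<in> U \<Longrightarrow> c \<cdot>\<^sub>v v \<in> U"
  shows "VectorSpace.subspace class_ring U (module_vec TYPE('a) n)"
  unfolding VectorSpace.subspace_def submodule_def
  using assms vec_vs vec_module by (auto simp: module_vec_simps)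

lemma subspace_mat_kernel:
  fixes A :: "'a :: field mat"
  assumes A: "A \<in> carrier_mat nr nc"
  shows "VectorSpace.subspace class_ring (mat_kernel A) (module_vec TYPE('a) nc)"
  by (rule subspace_vecI)
    (use A in \<open>auto simp: mat_kernel[OF A] mult_add_distrib_mat_vec[OF A] mult_mat_vec[OF A]\<close>)

lemma linear_map_mult_mat_vec:
  fixes F :: "'a :: field mat"
  assumes F: "F \<in> carrier_mat m n"
    and U: "VectorSpace.subspace class_ring U (module_vec TYPE('a) n)"
    and W: "VectorSpace.subspace class_ring W (module_vec TYPE('a) m)"
    and maps: "\<And>v. v \<in> U \<Longrightarrow> F *\<^sub>v v \<in> W"
  shows "linear_map class_ring (sub_vs n U) (sub_vs m W) ((*\<^sub>v) F)"
proof -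
  have sub: "U \<subseteq> carrier_vec n"
    using U unfolding VectorSpace.subspace_def submodule_def by (auto simp: module_vec_simps)
  have vsU: "vectorspace class_ring (sub_vs n U)"
    and vsW: "vectorspace class_ring (sub_vs m W)"
    using vectorspace.subspace_is_vs[OF vec_vs U] vectorspace.subspace_is_vs[OF vec_vs W] .
  have "(*\<^sub>v) F \<in> LinearCombinations.module_hom class_ring (sub_vs n U) (sub_vs m W)"
    unfolding LinearCombinations.module_hom_def
    using maps sub mult_add_distrib_mat_vec[OF F] mult_mat_vec[OF F]
    by (auto simp: module_vec_simps subset_iff)
  with vsU vsW show ?thesis
    unfolding linear_map_def mod_hom_def mod_hom_axioms_def vectorspace_def by auto
qed

text \<open>An injective linear map carries a basis of its domain to a linearly independent set. It is
  applied below both to kernels and to ranges.\<close>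
lemma (in linear_map) dim_le_of_inj:
  assumes "V.fin_dim" "W.fin_dim" "inj_on T (carrier V)"
  shows "V.dim \<le> W.dim"
proof -
  obtain B where fin: "finite B" and B: "V.basis B"
    using V.finite_basis_exists[OF assms(1)] by auto
  have BV: "B \<subseteq> carrier V" using B unfolding V.basis_def by auto
  have card: "card (T ` B) = card B"
    using assms(3) BV by (meson card_image inj_on_subset)
  have "W.module.lin_indpt (T ` B)"
  proof (rule W.module.finite_lin_indpt2)
    show "finite (T ` B)" using fin by simp
    show "T ` B \<subseteq> carrier W" using BV by auto
    fix a assume a: "a \<in> T ` B \<rightarrow> carrier K" and lc: "W.module.lincomb a (T ` B) = \<zero>\<^bsub>W\<^esub>"
    have aT: "a \<circ> T \<in> B \<rightarrow> carrier K" using a by auto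
    have "T (V.module.lincomb (a \<circ> T) B) = T \<zero>\<^bsub>V\<^esub>"
      using lincomb_linear_image[OF assms(3) BV a fin] lc by simp
    then have "V.module.lincomb (a \<circ> T) B = \<zero>\<^bsub>V\<^esub>"
      using inj_onD[OF assms(3) _ V.module.lincomb_closed[OF BV aT] V.module.M.zero_closed] by blast
    then have "a \<circ> T \<in> B \<rightarrow> {\<zero>\<^bsub>K\<^esub>}"
      using V.not_lindepD[of B B] B fin aT unfolding V.basis_def by auto
    then show "\<forall>v\<in>T ` B. a v = \<zero>\<^bsub>K\<^esub>" by auto
  qed
  moreover have "T ` B \<subseteq> carrier W" using BV by auto
  ultimately have "card (T ` B) \<le> W.dim"
    using W.li_le_dim(2)[OF assms(2)] by blast
  then show ?thesis using V.dim_basis[OF fin B] card by simp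
qed

lemma (in linear_map) fin_dim_im:
  assumes "V.fin_dim"
  shows "vectorspace.fin_dim K (W.vs imT)"
proof -
  interpret im: vectorspace K "W.vs imT"
    using W.subspace_is_vs[OF imT_is_subspace] .
  interpret R: linear_map K V "W.vs imT" T
    by (unfold_locales) (auto simp: LinearCombinations.module_hom_def im_def)
  show ?thesis using R.surj_fin_dim[OF assms] by (simp add: im_def)
qed

lemma fin_dim_mat_kernel:
  fixes A :: "'a :: field mat"
  assumes A: "A \<in> carrier_mat nr nc"
  shows "vectorspace.fin_dim class_ring (sub_vs nc (mat_kernel A))"
proof -
  interpret kernel nr nc A using A by unfold_locales
  show ?thesis
    using kernel_basis_exists[OF A] unfolding Ker.basis_def Ker.fin_dim_def by auto
qed

lemma inj_on_mult_mat_vec: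
  fixes F :: "'a :: field mat"
  assumes F: "F \<in> carrier_mat m n"
    and U: "VectorSpace.subspace class_ring U (module_vec TYPE('a) n)"
    and zero: "\<And>v. v \<in> U \<Longrightarrow> F *\<^sub>v v = 0\<^sub>v m \<Longrightarrow> v = 0\<^sub>v n"
  shows "inj_on ((*\<^sub>v) F) U"
proof (rule inj_onI)
  fix x y assume x: "x \<in> U" and y: "y \<in> U" and eq: "F *\<^sub>v x = F *\<^sub>v y"
  have sub: "U \<subseteq> carrier_vec n" 
    using U unfolding VectorSpace.subspace_def submodule_def by (auto simp: module_vec_simps)
  have xc: "x \<in> carrier_vec n" and yc: "y \<in> carrier_vec n" using x y sub by auto
  have "x + (-1) \<cdot>\<^sub>v y \<in> U"
    using U x y unfolding VectorSpace.subspace_def submodule_def by (auto simp: module_vec_simps)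
  moreover have "x + (-1) \<cdot>\<^sub>v y = x - y" using xc yc by auto
  ultimately have "x - y \<in> U" by simp
  moreover have "F *\<^sub>v (x - y) = 0\<^sub>v m"
    using mult_minus_distrib_mat_vec[OF F xc yc] eq F xc yc by auto
  ultimately have "x - y = 0\<^sub>v n" by (rule zero)
  then have "x - y + y = 0\<^sub>v n + y" by simp
  then show "x = y" using xc yc by (simp add: minus_add_uminus_vec)
qed

text \<open>The form in which generalized eigenspaces of different matrices are compared: one matrix
  that sends \<open>ker A\<close> into \<open>ker B\<close> and kills no nonzero vector of \<open>ker A\<close> bounds the dimension.\<close>
lemma kernel_dim_le_of_inj:
  fixes A B F :: "'a :: field mat"
  assumes A: "A \<in> carrier_mat r n" and B: "B \<in> carrier_mat s m" and F: "F \<in> carrier_mat m n"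
    and maps: "\<And>v. v \<in> mat_kernel A \<Longrightarrow> F *\<^sub>v v \<in> mat_kernel B"
    and inj: "\<And>v. v \<in> mat_kernel A \<Longrightarrow> F *\<^sub>v v = 0\<^sub>v m \<Longrightarrow> v = 0\<^sub>v n"
  shows "kernel_dim A \<le> kernel_dim B"
proof -
  interpret linear_map class_ring "sub_vs n (mat_kernel A)" "sub_vs m (mat_kernel B)" "(*\<^sub>v) F"
    using linear_map_mult_mat_vec[OF F subspace_mat_kernel[OF A] subspace_mat_kernel[OF B] maps] .
  show ?thesis
    using dim_le_of_inj[OF fin_dim_mat_kernel[OF A] fin_dim_mat_kernel[OF B]]
      inj_on_mult_mat_vec[OF F subspace_mat_kernel[OF A] inj] A B
    unfolding kernel_dim_def by simp
qed

text \<open>Rank-nullity for the map \<open>v \<mapsto> Av\<close> on the full space, together with the two facts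
  about its range that make ranks of different matrices comparable.\<close>
lemma rank_nullity_mat:
  fixes A :: "'a :: field mat"
  assumes A: "A \<in> carrier_mat m n"
  shows "vectorspace.dim class_ring (sub_vs m ((*\<^sub>v) A ` carrier_vec n)) + kernel_dim A = n"
    and "vectorspace.fin_dim class_ring (sub_vs m ((*\<^sub>v) A ` carrier_vec n))"
    and "VectorSpace.subspace class_ring ((*\<^sub>v) A ` carrier_vec n) (module_vec TYPE('a) m)"
proof -
  interpret V: vec_space "TYPE('a)" n .
  have full: "VectorSpace.subspace class_ring (carrier_vec k) (module_vec TYPE('a) k)" for k
    by (rule subspace_vecI) auto
  have id: "sub_vs k (carrier_vec k) = module_vec TYPE('a) k" for k
    by (simp add: module_vec_def)
  interpret L: linear_map class_ring "module_vec TYPE('a) n" "module_vec TYPE('a) m" "(*\<^sub>v) A"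
    using linear_map_mult_mat_vec[OF A full full] A unfolding id by auto
  have im: "L.imT = (*\<^sub>v) A ` carrier_vec n" by (simp add: L.im_def module_vec_simps)
  have ker: "L.kerT = mat_kernel A" using A by (auto simp: L.ker_def mat_kernel module_vec_simps)
  show "vectorspace.dim class_ring (sub_vs m ((*\<^sub>v) A ` carrier_vec n)) + kernel_dim A = n"
    using L.rank_nullity[OF V.fin_dim] A unfolding im ker kernel_dim_def V.dim_is_n by simp
  show "vectorspace.fin_dim class_ring (sub_vs m ((*\<^sub>v) A ` carrier_vec n))"
    using L.fin_dim_im[OF V.fin_dim] unfolding im .
  show "VectorSpace.subspace class_ring ((*\<^sub>v) A ` carrier_vec n) (module_vec TYPE('a) m)"
    using L.imT_is_subspace unfolding im .
qed


section \<open>Powers and adjoints of matrices\<close>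

lemma mult_mat_zero_vec:
  fixes A :: "'a :: semiring_1 mat"
  assumes "A \<in> carrier_mat m n"
  shows "A *\<^sub>v 0\<^sub>v n = 0\<^sub>v m"
  using assms by (intro eq_vecI) auto

lemma intertwine_pow_mat:
  fixes F :: "'a :: semiring_1 mat"
  assumes C: "C \<in> carrier_mat n n" and D: "D \<in> carrier_mat m m" and F: "F \<in> carrier_mat m n"
    and comm: "F * C = D * F"
  shows "F * C ^\<^sub>m k = D ^\<^sub>m k * F"
proof (induction k)
  case 0
  then show ?case using C D F by simp
next
  case (Suc k)
  have "F * (C ^\<^sub>m k * C) = F * C ^\<^sub>m k * C"
    using C F by (simp add: assoc_mult_mat[of _ m n _ n _ n])
  also have "\<dots> = D ^\<^sub>m k * (F * C)"
    using C D F Suc by (simp add: assoc_mult_mat[of _ m m _ n _ n])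
  also have "\<dots> = D ^\<^sub>m k * D * F"
    unfolding comm using D F by (simp add: assoc_mult_mat[of _ m m _ m _ n])
  finally show ?case by simp
qed

lemma pow_mat_commute:
  fixes A :: "'a :: semiring_1 mat"
  assumes A: "A \<in> carrier_mat n n"
  shows "A * A ^\<^sub>m k = A ^\<^sub>m k * A"
  by (rule intertwine_pow_mat[OF A A A refl])

lemma mat_adjoint_dim [simp]:
  "dim_row (mat_adjoint A) = dim_col A" "dim_col (mat_adjoint A) = dim_row A"
  by (simp_all add: mat_adjoint_def)

lemma mat_adjoint_carrier [simp]:
  "mat_adjoint A \<in> carrier_mat n m \<longleftrightarrow> A \<in> carrier_mat m n"
  unfolding carrier_mat_def by auto

lemma mat_adjoint_index [simp]:
  "i < dim_col A \<Longrightarrow> j < dim_row A \<Longrightarrow> mat_adjoint A $$ (i, j) = conjugate (A $$ (j, i))"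
  by (simp add: mat_adjoint_def mat_of_rows_index)

lemma mat_adjoint_adjoint [simp]: "mat_adjoint (mat_adjoint A) = A"
  by (rule eq_matI) simp_all

lemma mat_adjoint_one [simp]: "mat_adjoint (1\<^sub>m n :: complex mat) = 1\<^sub>m n"
  by (rule eq_matI) simp_all

lemma mat_adjoint_mult:
  fixes A B :: "complex mat"
  assumes A: "A \<in> carrier_mat l m" and B: "B \<in> carrier_mat m n"
  shows "mat_adjoint (A * B) = mat_adjoint B * mat_adjoint A"
proof (rule eq_matI)
  fix i j assume "i < dim_row (mat_adjoint B * mat_adjoint A)" "j < dim_col (mat_adjoint B * mat_adjoint A)"
  then show "mat_adjoint (A * B) $$ (i, j) = (mat_adjoint B * mat_adjoint A) $$ (i, j)"
    using A B by (simp add: scalar_prod_def mult.commute)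
qed (use A B in auto)

lemma mat_adjoint_pow:
  fixes A :: "complex mat"
  assumes A: "A \<in> carrier_mat n n"
  shows "mat_adjoint (A ^\<^sub>m k) = mat_adjoint A ^\<^sub>m k"
proof (induction k)
  case 0
  then show ?case using A by simp
next
  case (Suc k)
  have "mat_adjoint (A ^\<^sub>m k * A) = mat_adjoint A * mat_adjoint (A ^\<^sub>m k)"
    using A by (intro mat_adjoint_mult) auto
  then show ?case using pow_mat_commute[of "mat_adjoint A" n k] A by (simp add: Suc)
qed

lemma cscalar_prod_adjoint:
  fixes A :: "complex mat"
  assumes A: "A \<in> carrier_mat m n" and v: "v \<in> carrier_vec n" and w: "w \<in> carrier_vec m"
  shows "(A *\<^sub>v v) \<bullet>c w = v \<bullet>c (mat_adjoint A *\<^sub>v w)"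
proof -
  have "(A *\<^sub>v v) \<bullet>c w = (\<Sum>i<m. \<Sum>j<n. A $$ (i, j) * v $ j * cnj (w $ i))"
    using A v w by (simp add: scalar_prod_def lessThan_atLeast0 sum_distrib_right)
  also have "\<dots> = (\<Sum>j<n. \<Sum>i<m. A $$ (i, j) * v $ j * cnj (w $ i))"
    by (rule sum.swap)
  also have "\<dots> = v \<bullet>c (mat_adjoint A *\<^sub>v w)"
    using A v w by (simp add: scalar_prod_def lessThan_atLeast0 sum_distrib_left mult_ac)
  finally show ?thesis .
qed

text \<open>The usual observation that \<open>A\<^sup>*A\<close> and \<open>A\<close> have the same kernel: \<open>\<langle>Av, Av\<rangle> = \<langle>v, A\<^sup>*Av\<rangle>\<close>.\<close>
lemma adjoint_mult_vec_eq_0D: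
  fixes A :: "complex mat"
  assumes A: "A \<in> carrier_mat m n" and v: "v \<in> carrier_vec n"
    and zero: "mat_adjoint A *\<^sub>v (A *\<^sub>v v) = 0\<^sub>v n"
  shows "A *\<^sub>v v = 0\<^sub>v m"
proof -
  have "(A *\<^sub>v v) \<bullet>c (A *\<^sub>v v) = v \<bullet>c (mat_adjoint A *\<^sub>v (A *\<^sub>v v))"
    using A v by (intro cscalar_prod_adjoint) auto
  also have "\<dots> = 0" using v by (simp add: zero)
  finally show ?thesis using A v by (subst (asm) conjugate_square_eq_0_vec[of _ m]) auto
qed

text \<open>The adjoint \<open>X\<^sup>*\<close> is injective on the range of \<open>X\<close>, because \<open>X\<^sup>*Xv = 0\<close> forces \<open>Xv = 0\<close>.
  Hence the rank of \<open>X\<close> is at most that of \<open>X\<^sup>*\<close>; rank-nullity turns this into an inequality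
  between kernels, and exchanging \<open>X\<close> and \<open>X\<^sup>*\<close> gives the converse.\<close>
lemma kernel_dim_adjoint:
  fixes X :: "complex mat"
  assumes X: "X \<in> carrier_mat n n"
  shows "kernel_dim (mat_adjoint X) = kernel_dim X"
proof -
  have le: "kernel_dim (mat_adjoint X) \<le> kernel_dim X" if X: "X \<in> carrier_mat n n" for X :: "complex mat"
  proof -
    let ?Y = "mat_adjoint X"
    have Y: "?Y \<in> carrier_mat n n" using X by simp
    let ?U = "(*\<^sub>v) X ` carrier_vec n" and ?W = "(*\<^sub>v) ?Y ` carrier_vec n"
    interpret L: linear_map class_ring "sub_vs n ?U" "sub_vs n ?W" "(*\<^sub>v) ?Y"
      by (rule linear_map_mult_mat_vec[OF Y rank_nullity_mat(3)[OF X] rank_nullity_mat(3)[OF Y]])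
        (use X in auto)
    have "inj_on ((*\<^sub>v) ?Y) ?U"
      by (rule inj_on_mult_mat_vec[OF Y rank_nullity_mat(3)[OF X]])
        (use adjoint_mult_vec_eq_0D[OF X] in auto)
    then have "L.V.dim \<le> L.W.dim"
      using L.dim_le_of_inj[OF rank_nullity_mat(2)[OF X] rank_nullity_mat(2)[OF Y]] by simp
    then show ?thesis using rank_nullity_mat(1)[OF X] rank_nullity_mat(1)[OF Y] by linarith
  qed
  from le[OF X] le[of "mat_adjoint X"] X show ?thesis by simp
qed


section \<open>The eigenvalue zero: positive semidefinite times normal\<close>

text \<open>The equality case of the Cauchy-Schwarz inequality for the semi-inner product
  \<open>\<langle>Ax, y\<rangle>\<close>. Put \<open>w = Av\<close>. Since \<open>\<langle>Av, v\<rangle> = 0\<close>, the value of the form at \<open>v + tw\<close> is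
  \<open>2t\<langle>w, w\<rangle> + t\<^sup>2\<langle>Aw, w\<rangle>\<close>; if \<open>w\<close> were nonzero, the linear term would make it negative
  for small negative \<open>t\<close>. This is the one place where positivity of \<open>A\<close>, and not just its being
  Hermitian, matters.\<close>
lemma psd_quadratic_form_zero:
  fixes A :: "complex mat"
  assumes A: "A \<in> carrier_mat n n" and psd: "psd_mat A" and v: "v \<in> carrier_vec n"
    and zero: "(A *\<^sub>v v) \<bullet>c v = 0"
  shows "A *\<^sub>v v = 0\<^sub>v n"
proof -
  define w where "w = A *\<^sub>v v"
  define a where "a = w \<bullet>c w"
  define b where "b = (A *\<^sub>v w) \<bullet>c w"
  have w: "w \<in> carrier_vec n" and Aw: "A *\<^sub>v w \<in> carrier_vec n" using A v by (simp_all add: w_def)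
  have nonneg: "0 \<le> (A *\<^sub>v x) \<bullet>c x" if "x \<in> carrier_vec n" for x
    using psd that A conjugate_vec_sprod_comm[of "A *\<^sub>v x" n x] by (simp add: psd_mat_def)
  have a0: "0 \<le> a" unfolding a_def by auto
  have b0: "0 \<le> b" unfolding b_def by (rule nonneg[OF w])
  have herm: "(A *\<^sub>v w) \<bullet>c v = a"
    using cscalar_prod_adjoint[OF A w v] psd by (simp add: psd_mat_def a_def w_def)
  have quad: "0 \<le> 2 * complex_of_real t * a + complex_of_real t ^ 2 * b" for t
  proof -
    let ?t = "complex_of_real t"
    have conj: "conjugate (v + ?t \<cdot>\<^sub>v w) = conjugate v + ?t \<cdot>\<^sub>v conjugate w"
      using v w by (simp add: conjugate_add_vec[of _ n] conjugate_smult_vec)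
    have "A *\<^sub>v (v + ?t \<cdot>\<^sub>v w) = w + ?t \<cdot>\<^sub>v (A *\<^sub>v w)"
      using A v w by (simp add: mult_add_distrib_mat_vec[OF A] mult_mat_vec[OF A] w_def)
    then have "(A *\<^sub>v (v + ?t \<cdot>\<^sub>v w)) \<bullet>c (v + ?t \<cdot>\<^sub>v w)
        = w \<bullet>c v + ?t * (w \<bullet>c w) + ?t * ((A *\<^sub>v w) \<bullet>c v) + ?t * (?t * ((A *\<^sub>v w) \<bullet>c w))"
      using v w Aw unfolding conj
      by (simp add: add_scalar_prod_distrib[of _ n] scalar_prod_add_distrib[of _ n] algebra_simps)
    also have "\<dots> = 2 * ?t * a + ?t ^ 2 * b"
      using zero herm by (simp add: a_def[symmetric] b_def[symmetric] w_def[symmetric] power2_eq_square algebra_simps)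
    finally show ?thesis using nonneg[of "v + ?t \<cdot>\<^sub>v w"] v w by simp
  qed
  define \<alpha> where "\<alpha> = Re a"
  define \<beta> where "\<beta> = Re b"
  have \<alpha>: "a = complex_of_real \<alpha>" and \<beta>: "b = complex_of_real \<beta>"
    using a0 b0 by (auto simp: \<alpha>_def \<beta>_def complex_eq_iff less_eq_complex_def)
  have "0 \<le> \<beta>" using b0 by (simp add: \<beta>_def less_eq_complex_def)
  have "0 \<le> 2 * t * \<alpha> + t ^ 2 * \<beta>" for t
  proof -
    have "0 \<le> complex_of_real (2 * t * \<alpha> + t ^ 2 * \<beta>)" using quad[of t] by (simp add: \<alpha> \<beta>)
    then show ?thesis by (simp only: less_eq_complex_def zero_complex.simps Re_complex_of_real)
  qed
  note quad_real = this
  \<comment> \<open>At \<open>t = - s\<close> the quadratic \<open>2t\<alpha> + t\<^sup>2\<beta>\<close> has the value \<open>- s\<^sup>2(\<beta> + 2)\<close>; the \<open>+ 1\<close> keeps the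
    denominator positive when \<open>\<beta> = 0\<close>.\<close>
  define s where "s = \<alpha> / (\<beta> + 1)"
  have \<alpha>_s: "\<alpha> = s * (\<beta> + 1)" using \<open>0 \<le> \<beta>\<close> by (simp add: s_def)
  have "2 * (- s) * \<alpha> + (- s)\<^sup>2 * \<beta> = - (s\<^sup>2 * (\<beta> + 2))"
    unfolding \<alpha>_s by (simp add: algebra_simps power2_eq_square)
  then have "s\<^sup>2 * (\<beta> + 2) \<le> 0" using quad_real[of "- s"] by linarith
  then have "s = 0" using \<open>0 \<le> \<beta>\<close> by (simp add: mult_le_0_iff)
  then have "\<alpha> = 0" using \<alpha>_s by simp
  then have "w \<bullet>c w = 0" using \<alpha> a_def by simp
  then show ?thesis using conjugate_square_eq_0_vec[OF w] by (simp add: w_def)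
qed

text \<open>Normality gives \<open>BB\<^sup>*v = B\<^sup>*Bv = 0\<close>, and \<open>BB\<^sup>*\<close> has the kernel of \<open>B\<^sup>*\<close>.\<close>
lemma normal_mat_adjoint_vec_eq_0:
  assumes B: "B \<in> carrier_mat n n" and normal: "normal_mat B"
    and v: "v \<in> carrier_vec n" and zero: "B *\<^sub>v v = 0\<^sub>v n"
  shows "mat_adjoint B *\<^sub>v v = 0\<^sub>v n"
proof (rule adjoint_mult_vec_eq_0D[OF _ v])
  have "B *\<^sub>v (mat_adjoint B *\<^sub>v v) = mat_adjoint B *\<^sub>v (B *\<^sub>v v)"
    using assoc_mult_mat_vec[OF B _ v, of "mat_adjoint B"] assoc_mult_mat_vec[OF _ B v, of "mat_adjoint B"]
      B normal unfolding normal_mat_def by (metis mat_adjoint_carrier)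
  then show "mat_adjoint (mat_adjoint B) *\<^sub>v (mat_adjoint B *\<^sub>v v) = 0\<^sub>v n"
    using mult_mat_zero_vec[of "mat_adjoint B" n n] B zero by simp
qed (use B in simp)

lemma normal_mat_adjoint:
  assumes "normal_mat B" shows "normal_mat (mat_adjoint B)"
  using assms unfolding normal_mat_def by simp

text \<open>The heart of the argument. Let \<open>u = ABz\<close>. From \<open>Bu = 0\<close> normality gives \<open>B\<^sup>*u = 0\<close>, so
  \<open>\<langle>A(Bz), Bz\<rangle> = \<langle>B\<^sup>*u, z\<rangle> = 0\<close>, and the quadratic form of \<open>A\<close> vanishes at \<open>Bz\<close> only if
  \<open>A(Bz) = 0\<close>.\<close>
lemma psd_normal_mult_vec_eq_0:
  assumes A: "A \<in> carrier_mat n n" and B: "B \<in> carrier_mat n n"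
    and psd: "psd_mat A" and normal: "normal_mat B"
    and z: "z \<in> carrier_vec n" and zero: "B *\<^sub>v (A *\<^sub>v (B *\<^sub>v z)) = 0\<^sub>v n"
  shows "A *\<^sub>v (B *\<^sub>v z) = 0\<^sub>v n"
proof (rule psd_quadratic_form_zero[OF A psd])
  let ?u = "A *\<^sub>v (B *\<^sub>v z)"
  have u: "?u \<in> carrier_vec n" using A B z by simp
  have "?u \<bullet>c (B *\<^sub>v z) = (mat_adjoint B *\<^sub>v ?u) \<bullet>c z"
    using cscalar_prod_adjoint[of "mat_adjoint B" n n ?u z] B z u by simp
  also have "\<dots> = 0"
    using normal_mat_adjoint_vec_eq_0[OF B normal u zero] z by simp
  finally show "?u \<bullet>c (B *\<^sub>v z) = 0" .
qed (use B z in simp)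

text \<open>In the powers of \<open>BA\<close> from the second on, the leftmost factor \<open>B\<close> does not
  enlarge the kernel: the vectors it is applied to have the form \<open>ABz\<close>. What remains is
  \<open>ABA \<dots> BA\<close>, a word beginning and ending in \<open>A\<close>, whose adjoint is the same word with
  \<open>B\<^sup>*\<close> for \<open>B\<close>.\<close>
lemma kernel_dim_strip_normal_factor:
  assumes A: "A \<in> carrier_mat n n" and B: "B \<in> carrier_mat n n"
    and psd: "psd_mat A" and normal: "normal_mat B"
  shows "kernel_dim ((B * A) ^\<^sub>m Suc (Suc k)) = kernel_dim (A * (B * A) ^\<^sub>m Suc k)"
proof -
  let ?M = "(B * A) ^\<^sub>m Suc k"
  have BA: "B * A \<in> carrier_mat n n" using A B by simp
  note M = pow_carrier_mat[OF BA, of "Suc k"]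
  note AM = mult_carrier_mat[OF A M]
  have pow: "(B * A) ^\<^sub>m Suc (Suc k) = B * (A * ?M)"
    using pow_mat_commute[OF BA, of "Suc k"] assoc_mult_mat[OF B A M] by simp
  have M': "?M = B * (A * (B * A) ^\<^sub>m k)"
    using pow_mat_commute[OF BA, of k] A B by (simp add: assoc_mult_mat[of _ n n _ n _ n])
  have "mat_kernel (B * (A * ?M)) = mat_kernel (A * ?M)"
  proof (rule antisym[OF _ mat_kernel_mult_subset[OF AM B]], rule subsetI)
    fix v assume "v \<in> mat_kernel (B * (A * ?M))"
    then have v: "v \<in> carrier_vec n" and zero: "(B * (A * ?M)) *\<^sub>v v = 0\<^sub>v n"
      using mat_kernelD[of "B * (A * ?M)" n n v] B AM by simp_all
    define z where "z = (A * (B * A) ^\<^sub>m k) *\<^sub>v v"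
    have z: "z \<in> carrier_vec n" unfolding z_def
      using mult_mat_vec_carrier[OF mult_carrier_mat[OF A pow_carrier_mat[OF BA]] v] .
    have Mv: "?M *\<^sub>v v = B *\<^sub>v z"
      unfolding M' z_def
      by (rule assoc_mult_mat_vec[OF B mult_carrier_mat[OF A pow_carrier_mat[OF BA]] v])
    have AMv: "(A * ?M) *\<^sub>v v = A *\<^sub>v (B *\<^sub>v z)"
      using assoc_mult_mat_vec[OF A M v] Mv by simp
    have "B *\<^sub>v (A *\<^sub>v (B *\<^sub>v z)) = 0\<^sub>v n"
      using assoc_mult_mat_vec[OF B AM v] zero AMv by simp
    then have "(A * ?M) *\<^sub>v v = 0\<^sub>v n"
      using psd_normal_mult_vec_eq_0[OF A B psd normal z] AMv by simp
    then show "v \<in> mat_kernel (A * ?M)" by (rule mat_kernelI[OF AM v])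
  qed
  then show ?thesis
    unfolding pow kernel_dim_def using A B by simp
qed

text \<open>The adjoint of \<open>(AB)\<^sup>k\<close> is \<open>(B\<^sup>*A)\<^sup>k\<close>, so the task is to replace \<open>B\<close> by \<open>B\<^sup>*\<close> in
  \<open>(BA)\<^sup>k\<close>. For \<open>k = 1\<close> this is immediate, as \<open>B\<close> and \<open>B\<^sup>*\<close> have the same kernel. For \<open>k \<ge> 2\<close> strip
  the leading \<open>B\<close>, take the adjoint of the remaining word, and restore a leading \<open>B\<^sup>*\<close>; the last step
  uses that \<open>B\<^sup>*\<close> is normal too.\<close>
lemma kernel_dim_pow_psd_normal_commute:
  assumes A: "A \<in> carrier_mat n n" and B: "B \<in> carrier_mat n n"
    and psd: "psd_mat A" and normal: "normal_mat B"
  shows "kernel_dim ((A * B) ^\<^sub>m k) = kernel_dim ((B * A) ^\<^sub>m k)"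
proof -
  let ?B = "mat_adjoint B"
  have herm: "mat_adjoint A = A" using psd by (simp add: psd_mat_def)
  have B': "?B \<in> carrier_mat n n" using B by simp
  have AB: "A * B \<in> carrier_mat n n" and BA: "B * A \<in> carrier_mat n n" and BA': "?B * A \<in> carrier_mat n n"
    using A B by simp_all
  have adj_AB: "mat_adjoint (A * B) = ?B * A" using mat_adjoint_mult[OF A B] herm by simp
  have adj_BA: "mat_adjoint (B * A) = A * ?B" using mat_adjoint_mult[OF B A] herm by simp
  have AB_adj: "kernel_dim ((A * B) ^\<^sub>m k) = kernel_dim ((?B * A) ^\<^sub>m k)" for k
    using kernel_dim_adjoint[of "(A * B) ^\<^sub>m k" n] AB by (simp add: mat_adjoint_pow[OF AB] adj_AB)
  consider "k = 0" | "k = 1" | m where "k = Suc (Suc m)"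
    by (metis One_nat_def not0_implies_Suc)
  then show ?thesis
  proof cases
    case 1
    then show ?thesis using A B by simp
  next
    case 2
    have eq: "?B *\<^sub>v (A *\<^sub>v v) = 0\<^sub>v n \<longleftrightarrow> B *\<^sub>v (A *\<^sub>v v) = 0\<^sub>v n" if "v \<in> carrier_vec n" for v
      using normal_mat_adjoint_vec_eq_0[OF B normal, of "A *\<^sub>v v"]
        normal_mat_adjoint_vec_eq_0[OF B' normal_mat_adjoint[OF normal], of "A *\<^sub>v v"] A that by auto
    have "mat_kernel (?B * A) = mat_kernel (B * A)"
      unfolding mat_kernel[OF BA] mat_kernel[OF BA'] 
      using eq assoc_mult_mat_vec[OF B A] assoc_mult_mat_vec[OF B' A] by auto
    then have "kernel_dim (?B * A) = kernel_dim (B * A)"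
      unfolding kernel_dim_def using A B by simp
    then show ?thesis using 2 AB_adj[of 1] AB BA BA' by simp
  next
    case 3
    let ?M = "(B * A) ^\<^sub>m Suc m"
    note M = pow_carrier_mat[OF BA, of "Suc m"]
    have "A * (?B * A) = A * ?B * A" using A B' by simp
    then have intertwine: "A * (?B * A) ^\<^sub>m j = (A * ?B) ^\<^sub>m j * A" for j
      by (intro intertwine_pow_mat[OF BA' _ A]) (use A B' in simp_all)
    have "mat_adjoint (A * ?M) = mat_adjoint ?M * A"
      unfolding mat_adjoint_mult[OF A M] herm ..
    also have "\<dots> = A * (?B * A) ^\<^sub>m Suc m"
      unfolding mat_adjoint_pow[OF BA] adj_BA by (rule intertwine[symmetric])
    finally have adj: "mat_adjoint (A * ?M) = A * (?B * A) ^\<^sub>m Suc m" .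
    have "kernel_dim ((B * A) ^\<^sub>m k) = kernel_dim (A * ?M)"
      unfolding 3 by (rule kernel_dim_strip_normal_factor[OF A B psd normal])
    also have "\<dots> = kernel_dim (A * (?B * A) ^\<^sub>m Suc m)"
      using kernel_dim_adjoint[OF mult_carrier_mat[OF A M]] unfolding adj ..
    also have "\<dots> = kernel_dim ((?B * A) ^\<^sub>m k)"
      unfolding 3 by (rule kernel_dim_strip_normal_factor[OF A B' psd normal_mat_adjoint[OF normal], symmetric])
    also have "\<dots> = kernel_dim ((A * B) ^\<^sub>m k)" using AB_adj by simp
    finally show ?thesis by simp
  qed
qed


section \<open>Nonzero eigenvalues of a product\<close>

lemma char_matrix_mult_vec:
  fixes A :: "'a :: field mat"
  assumes A: "A \<in> carrier_mat n n" and v: "v \<in> carrier_vec n"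
  shows "char_matrix A e *\<^sub>v v = A *\<^sub>v v + (- e) \<cdot>\<^sub>v v"
proof -
  have "((- e) \<cdot>\<^sub>m 1\<^sub>m n) *\<^sub>v v = (- e) \<cdot>\<^sub>v v"
    using v by (intro eq_vecI) auto
  then show ?thesis
    using A v by (simp add: char_matrix_def add_mult_distrib_mat_vec[of _ n n])
qed

text \<open>\<open>B\<close> intertwines \<open>AB - e\<close> with \<open>BA - e\<close>, hence also their powers, and so maps generalized
  eigenspaces of \<open>AB\<close> into those of \<open>BA\<close>. It is injective there: on a vector with \<open>Bv = 0\<close> the matrix
  \<open>(AB - e)\<^sup>k\<close> acts as the nonzero scalar \<open>(- e)\<^sup>k\<close>.\<close>
lemma dim_gen_eigenspace_nonzero_le:
  fixes A B :: "'a :: field mat"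
  assumes A: "A \<in> carrier_mat n m" and B: "B \<in> carrier_mat m n" and e: "e \<noteq> 0"
  shows "dim_gen_eigenspace (A * B) e k \<le> dim_gen_eigenspace (B * A) e k"
proof -
  let ?C = "char_matrix (A * B) e" and ?D = "char_matrix (B * A) e"
  have AB: "A * B \<in> carrier_mat n n" and BA: "B * A \<in> carrier_mat m m" using A B by simp_all
  have C: "?C \<in> carrier_mat n n" and D: "?D \<in> carrier_mat m m" using AB BA by simp_all
  have Ck: "?C ^\<^sub>m k \<in> carrier_mat n n" and Dk: "?D ^\<^sub>m k \<in> carrier_mat m m" for k using C D by simp_all
  have "B * ?C = B * (A * B) + B * ((- e) \<cdot>\<^sub>m 1\<^sub>m n)"
    unfolding char_matrix_def using A B by (simp add: mult_add_distrib_mat[of _ m n _ n])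
  also have "B * ((- e) \<cdot>\<^sub>m 1\<^sub>m n) = ((- e) \<cdot>\<^sub>m 1\<^sub>m m) * B"
    using B by (simp add: mult_smult_distrib[of _ m n _ n] mult_smult_assoc_mat[of _ m m _ n])
  also have "B * (A * B) = B * A * B" using A B by simp
  also have "B * A * B + ((- e) \<cdot>\<^sub>m 1\<^sub>m m) * B = ?D * B"
    unfolding char_matrix_def using A B by (simp add: add_mult_distrib_mat[of _ m m _ _ n])
  finally have comm: "B * ?C ^\<^sub>m k = ?D ^\<^sub>m k * B" for k
    by (rule intertwine_pow_mat[OF C D B])
  show ?thesis
    unfolding dim_gen_eigenspace_def
  proof (rule kernel_dim_le_of_inj[OF Ck Dk B])
    fix v assume "v \<in> mat_kernel (?C ^\<^sub>m k)"
    then have v: "v \<in> carrier_vec n" and zero: "?C ^\<^sub>m k *\<^sub>v v = 0\<^sub>v n"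
      using mat_kernelD[OF Ck] by auto
    have "?D ^\<^sub>m k *\<^sub>v (B *\<^sub>v v) = (?D ^\<^sub>m k * B) *\<^sub>v v"
      by (rule assoc_mult_mat_vec[OF Dk B v, symmetric])
    also have "\<dots> = B *\<^sub>v (?C ^\<^sub>m k *\<^sub>v v)"
      unfolding comm[symmetric] by (rule assoc_mult_mat_vec[OF B Ck v])
    also have "\<dots> = 0\<^sub>v m" unfolding zero by (rule mult_mat_zero_vec[OF B])
    finally show "B *\<^sub>v v \<in> mat_kernel (?D ^\<^sub>m k)"
      using mat_kernelI[OF Dk] B v by simp
    assume Bv: "B *\<^sub>v v = 0\<^sub>v m"
    have "(A * B) *\<^sub>v v = 0\<^sub>v n"
      unfolding assoc_mult_mat_vec[OF A B v] Bv by (rule mult_mat_zero_vec[OF A])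
    then have Cv: "?C *\<^sub>v v = (- e) \<cdot>\<^sub>v v"
      using char_matrix_mult_vec[OF AB v] v by simp
    have "?C ^\<^sub>m j *\<^sub>v v = ((- e) ^ j) \<cdot>\<^sub>v v" for j
    proof (induction j)
      case 0
      have "dim_row ?C = n" using C by blast
      then show ?case using v by simp
    next
      case (Suc j)
      have "?C ^\<^sub>m Suc j *\<^sub>v v = ?C ^\<^sub>m j *\<^sub>v (?C *\<^sub>v v)"
        using assoc_mult_mat_vec[OF Ck C v] by simp
      also have "\<dots> = (- e) \<cdot>\<^sub>v (?C ^\<^sub>m j *\<^sub>v v)"
        unfolding Cv by (rule mult_mat_vec[OF Ck v])
      finally show ?case unfolding Suc by (simp add: smult_smult_assoc)
    qed
    then have "((- e) ^ k) \<cdot>\<^sub>v v = 0\<^sub>v n" using zero by simp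
    then show "v = 0\<^sub>v n" using v e by (auto simp: vec_eq_iff)
  qed
qed


section \<open>Similarity from equal generalized eigenspaces\<close>

text \<open>Conjugation with the permutation matrix that exchanges the two blocks of coordinates.\<close>
lemma similar_mat_four_block_swap:
  fixes A B :: "'a :: comm_ring_1 mat"
  assumes A: "A \<in> carrier_mat n n" and B: "B \<in> carrier_mat m m"
  shows "similar_mat (four_block_mat A (0\<^sub>m n m) (0\<^sub>m m n) B) (four_block_mat B (0\<^sub>m m n) (0\<^sub>m n m) A)"
proof -
  let ?P = "four_block_mat (0\<^sub>m n m) (1\<^sub>m n) (1\<^sub>m m) (0\<^sub>m m n) :: 'a mat"
  let ?Q = "four_block_mat (0\<^sub>m m n) (1\<^sub>m m) (1\<^sub>m n) (0\<^sub>m n m) :: 'a mat"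
  let ?X = "four_block_mat A (0\<^sub>m n m) (0\<^sub>m m n) B"
  let ?Y = "four_block_mat B (0\<^sub>m m n) (0\<^sub>m n m) A"
  have PQ: "?P * ?Q = 1\<^sub>m (n + m)"
    by (subst mult_four_block_mat[of _ n m _ n _ m _ _ n _ m]) auto
  have QP: "?Q * ?P = 1\<^sub>m (m + n)"
    by (subst mult_four_block_mat[of _ m n _ m _ n _ _ m _ n]) auto
  have PY: "?P * ?Y = four_block_mat (0\<^sub>m n m) A B (0\<^sub>m m n)"
    using A B by (subst mult_four_block_mat[of _ n m _ n _ m _ _ m _ n]) auto
  have PYQ: "?P * ?Y * ?Q = ?X"
    unfolding PY using A B by (subst mult_four_block_mat[of _ n m _ n _ m _ _ n _ m]) auto
  have P: "?P \<in> carrier_mat (n + m) (n + m)"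
    using four_block_carrier_mat[OF zero_carrier_mat[of n m] zero_carrier_mat[of m n]] by (simp add: add.commute)
  have Q: "?Q \<in> carrier_mat (n + m) (n + m)"
    using four_block_carrier_mat[OF zero_carrier_mat[of m n] zero_carrier_mat[of n m]] by (simp add: add.commute)
  have X: "?X \<in> carrier_mat (n + m) (n + m)" and Y: "?Y \<in> carrier_mat (n + m) (n + m)"
    using four_block_carrier_mat[OF A B] four_block_carrier_mat[OF B A] by (simp_all add: add.commute)
  show ?thesis
    using similar_matI[OF _ PQ QP[unfolded add.commute[of m n]] PYQ[symmetric]] P Q X Y by blast
qed

lemma jordan_matrix_append:
  "jordan_matrix (xs @ ys) = four_block_mat
    (jordan_matrix xs) (0\<^sub>m (sum_list (map fst xs)) (sum_list (map fst ys)))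
    (0\<^sub>m (sum_list (map fst ys)) (sum_list (map fst xs))) (jordan_matrix ys)"
proof -
  have "jordan_matrix (xs @ ys) = (let A = jordan_matrix xs; B = jordan_matrix ys
    in four_block_mat A (0\<^sub>m (dim_row A) (dim_col B)) (0\<^sub>m (dim_row B) (dim_col A)) B)"
    unfolding jordan_matrix_def by (simp only: map_append diag_block_mat_append)
  then show ?thesis by (simp only: Let_def jordan_matrix_dim)
qed

lemma similar_jordan_matrix_append:
  fixes xs ys :: "(nat \<times> 'a :: comm_ring_1) list"
  assumes "similar_mat (jordan_matrix xs) (jordan_matrix xs')" 
    and "similar_mat (jordan_matrix ys) (jordan_matrix ys')"
  shows "similar_mat (jordan_matrix (xs @ ys)) (jordan_matrix (xs' @ ys'))"
proof -
  have "sum_list (map fst xs) = sum_list (map fst xs')" "sum_list (map fst ys) = sum_list (map fst ys')"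
    using similar_matD[OF assms(1)] similar_matD[OF assms(2)]
    by (metis carrier_matD(1) insert_subset jordan_matrix_dim(1))+
  then show ?thesis
    using similar_mat_four_block_0_0[OF assms jordan_matrix_carrier jordan_matrix_carrier]
    unfolding jordan_matrix_append by simp
qed

text \<open>Moving a single block past a list of blocks is one swap, so any reordering of the Jordan blocks
  can be realised by similarities.\<close>
lemma similar_jordan_matrix_of_mset_eq:
  fixes xs ys :: "(nat \<times> 'a :: comm_ring_1) list"
  assumes "mset xs = mset ys"
  shows "similar_mat (jordan_matrix xs) (jordan_matrix ys)"
  using assms
proof (induction xs arbitrary: ys)
  case Nil
  then show ?case by (auto intro: similar_mat_refl jordan_matrix_carrier)
next
  case (Cons x xs)
  note refl' = similar_mat_refl[OF jordan_matrix_carrier]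
  from Cons.prems have "x \<in> set ys" by (metis list.set_intros(1) mset_eq_setD)
  then obtain ys1 ys2 where ys: "ys = ys1 @ x # ys2" by (auto simp: in_set_conv_decomp)
  have "similar_mat (jordan_matrix ([x] @ xs)) (jordan_matrix ([x] @ (ys1 @ ys2)))"
    using Cons ys by (intro similar_jordan_matrix_append refl' Cons.IH) simp
  moreover have "similar_mat (jordan_matrix (([x] @ ys1) @ ys2)) (jordan_matrix ((ys1 @ [x]) @ ys2))"
  proof (rule similar_jordan_matrix_append[OF _ refl'])
    show "similar_mat (jordan_matrix ([x] @ ys1)) (jordan_matrix (ys1 @ [x]))"
      unfolding jordan_matrix_append by (intro similar_mat_four_block_swap jordan_matrix_carrier)
  qed
  ultimately show ?case unfolding ys by (auto intro: similar_mat_trans)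
qed

text \<open>The number of Jordan blocks of size \<open>k > 0\<close> for an eigenvalue is determined by the
  dimensions of its generalized eigenspaces. A Jordan normal form has no blocks of size \<open>0\<close>, so
  nothing else is left to count.\<close>
lemma jordan_nf_mset_eq:
  fixes A B :: "'a :: field mat"
  assumes A: "jordan_nf A xs" and B: "jordan_nf B ys"
    and dims: "dim_gen_eigenspace A = dim_gen_eigenspace B"
  shows "mset xs = mset ys"
proof (rule multiset_eqI)
  fix x :: "nat \<times> 'a"
  obtain k e where x: "x = (k, e)" by force
  show "count (mset xs) x = count (mset ys) x"
  proof (cases "k = 0")
    case True
    then have "x \<notin> set xs" "x \<notin> set ys"
      using A B x unfolding jordan_nf_def by force+
    then show ?thesis by (metis count_eq_zero_iff set_mset_mset)
  next
    case False
    have "compute_nr_of_jordan_blocks A e k = compute_nr_of_jordan_blocks B e k"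
      unfolding compute_nr_of_jordan_blocks_def dims ..
    then show ?thesis
      unfolding compute_nr_of_jordan_blocks[OF A False] compute_nr_of_jordan_blocks[OF B False] x
      by (simp add: count_mset count_list_eq_length_filter)
  qed
qed

lemma similar_mat_of_dim_gen_eigenspace:
  fixes A B :: "complex mat"
  assumes A: "A \<in> carrier_mat n n" and B: "B \<in> carrier_mat n n"
    and dims: "dim_gen_eigenspace A = dim_gen_eigenspace B"
  shows "similar_mat A B"
proof -
  obtain xs ys where xs: "jordan_nf A xs" and ys: "jordan_nf B ys"
    using jordan_nf_exists[OF A] jordan_nf_exists[OF B]
      char_poly_factorized[OF A] char_poly_factorized[OF B] by blast
  have "similar_mat (jordan_matrix xs) (jordan_matrix ys)"
    by (rule similar_jordan_matrix_of_mset_eq[OF jordan_nf_mset_eq[OF xs ys dims]])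
  then show ?thesis
    using xs ys unfolding jordan_nf_def by (meson similar_mat_sym similar_mat_trans)
qed


section \<open>Similarity of the two products\<close>

theorem theorem6p1:
  fixes A B :: "complex mat" and n :: nat
  assumes "A \<in> carrier_mat n n" and "B \<in> carrier_mat n n"
    and "psd_mat A" and "normal_mat B"
  shows "similar_mat (A * B) (B * A)"
proof -
  have AB: "A * B \<in> carrier_mat n n" and BA: "B * A \<in> carrier_mat n n"
    using assms(1,2) by simp_all
  have char_0: "char_matrix X 0 = X" if "X \<in> carrier_mat n n" for X :: "complex mat"
    using that by (intro eq_matI) (auto simp: char_matrix_def)
  have "dim_gen_eigenspace (A * B) e k = dim_gen_eigenspace (B * A) e k" for e k
  proof (cases "e = 0")
    case True
    show ?thesis
      unfolding True dim_gen_eigenspace_def char_0[OF AB] char_0[OF BA]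
      by (rule kernel_dim_pow_psd_normal_commute[OF assms])
  next
    case False
    show ?thesis
      using dim_gen_eigenspace_nonzero_le[OF assms(1,2) False]
        dim_gen_eigenspace_nonzero_le[OF assms(2,1) False] by (rule antisym)
  qed
  then show ?thesis
    by (intro similar_mat_of_dim_gen_eigenspace[OF AB BA]) (simp add: fun_eq_iff)
qed

end
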